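(* Let $A$ be a separable C*-algebra (with or without a unit) and let $L$ be a seminorm defined on a norm-dense subspace $\operatorname{dom}L$ of the self-adjoint part $A^{sa}$ of $A$. Let $\mathcal{B}_L=\{a\in\operatorname{dom}L: L(a)\leq 1,\ \|a\|\leq 1\}$. The bounded-Lipschitz distance $d_L$ dual to $L$ metrizes the weak* topology on the state space $S(A)$ of $A$ if and only if the set $\mathcal{B}_L$ is totally bounded for the weakly-uniform topology $\mathrm{wu}$ on $A$.
   Context: $\|\cdot\|$ is the norm of $A$; $S(A)$ is the state space of $A$ with the restriction of the weak* topology $\sigma(A',A)$. The bounded-Lipschitz distance dual to $L$ is $d_L(\varphi,\psi)=\sup\{|\varphi(a)-\psi(a)|: a\in\mathcal{B}_L\}$ for $\varphi,\psi\in S(A)$; "$d_L$ metrizes the weak* topology on $S(A)$" means that the topology of $d_L$ equals the weak* topology on $S(A)$. Weakly-uniform topology: for each weak* compact subset $K$ of $S(A)$ let $p_K(a)=\sup_{\varphi\in K}|\varphi(a)|$ for $a\in A$. The topology $\mathrm{wu}$ is the locally convex topology on $A$ generated by all the seminorms $p_K$, $K$ ranging over the weak* compact subsets of $S(A)$. A set $V\subseteq A$ is totally bounded for $\mathrm{wu}$ if for every $\mathrm{wu}$-open neighborhood $U$ of $0$ there is a finite set $F\subseteq A$ with $V\subseteq U+F$. *)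

theory Defs
  imports "HOL-Analysis.Analysis"
begin

text \<open>A C*-algebra, not assumed to have a unit. The real scalar multiplication, the norm and the
  norm topology come from the superclasses; \<open>scaleC\<close> extends the scalars to the complex numbers.\<close>

class cstar_algebra = real_normed_algebra + banach +
  fixes scaleC :: "complex \<Rightarrow> 'a \<Rightarrow> 'a"
    and adj :: "'a \<Rightarrow> 'a"
  assumes scaleC_add_right: "scaleC c (x + y) = scaleC c x + scaleC c y"
    and scaleC_add_left: "scaleC (b + c) x = scaleC b x + scaleC c x"
    and scaleC_scaleC: "scaleC b (scaleC c x) = scaleC (b * c) x"
    and scaleC_of_real: "scaleC (complex_of_real r) x = scaleR r x"
    and norm_scaleC: "norm (scaleC c x) = cmod c * norm x"
    and mult_scaleC_left: "scaleC c x * y = scaleC c (x * y)"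
    and mult_scaleC_right: "x * scaleC c y = scaleC c (x * y)"
    and adj_add: "adj (x + y) = adj x + adj y"
    and adj_scaleC: "adj (scaleC c x) = scaleC (cnj c) (adj x)"
    and adj_mult: "adj (x * y) = adj y * adj x"
    and adj_adj: "adj (adj x) = x"
    and cstar_identity: "norm (adj x * x) = (norm x)\<^sup>2"

definition self_adjoint :: "'a::cstar_algebra set" where
  "self_adjoint = {a. adj a = a}"

definition dual_space :: "('a::cstar_algebra \<Rightarrow> complex) set" where
  "dual_space = {\<phi>. bounded_linear \<phi> \<and> (\<forall>c x. \<phi> (scaleC c x) = c * \<phi> x)}"

text \<open>The weak* topology \<open>\<sigma>(A', A)\<close>: the initial topology on the dual for all evaluations.\<close>

definition weak_star :: "('a::cstar_algebra \<Rightarrow> complex) topology" where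
  "weak_star = topology_generated_by {{\<phi> \<in> dual_space. \<phi> a \<in> U} | a U. open U}"

definition states :: "('a::cstar_algebra \<Rightarrow> complex) set" where
  "states = {\<phi> \<in> dual_space. (\<forall>a. \<phi> (adj a * a) \<in> \<real>\<^sub>\<ge>\<^sub>0) \<and> onorm \<phi> = 1}"

definition state_topology :: "('a::cstar_algebra \<Rightarrow> complex) topology" where
  "state_topology = subtopology weak_star states"

lemma topspace_weak_star: "topspace weak_star = dual_space"
proof -
  have "dual_space \<in> {{\<phi> \<in> dual_space. \<phi> (a :: 'a) \<in> U} | a U. open U}"
    by (rule CollectI, rule exI[of _ 0], rule exI[of _ UNIV]) simp
  then show ?thesis
    unfolding weak_star_def topology_generated_by_topspace by blast
qed

lemma topspace_state_topology: "topspace state_topology = states"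
  by (auto simp: state_topology_def topspace_weak_star states_def)

definition seminorm_on :: "'a::real_vector set \<Rightarrow> ('a \<Rightarrow> real) \<Rightarrow> bool" where
  "seminorm_on D L \<longleftrightarrow> subspace D \<and>
     (\<forall>a\<in>D. 0 \<le> L a) \<and>
     (\<forall>a\<in>D. \<forall>b\<in>D. L (a + b) \<le> L a + L b) \<and>
     (\<forall>r. \<forall>a\<in>D. L (scaleR r a) = \<bar>r\<bar> * L a)"

definition lip_ball :: "'a::cstar_algebra set \<Rightarrow> ('a \<Rightarrow> real) \<Rightarrow> 'a set" where
  "lip_ball D L = {a \<in> D. L a \<le> 1 \<and> norm a \<le> 1}"

text \<open>Only the values on pairs of states matter. The value 0 elsewhere is needed because
  \<^const>\<open>Metric_space\<close> requires nonnegativity and symmetry on the whole type, and the supremum of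
  an unbounded set of reals is unspecified.\<close>

definition bl_dist ::
    "'a::cstar_algebra set \<Rightarrow> ('a \<Rightarrow> real) \<Rightarrow> ('a \<Rightarrow> complex) \<Rightarrow> ('a \<Rightarrow> complex) \<Rightarrow> real" where
  "bl_dist D L \<phi> \<psi> =
     (if \<phi> \<in> states \<and> \<psi> \<in> states then (SUP a\<in>lip_ball D L. cmod (\<phi> a - \<psi> a)) else 0)"

definition metrizes :: "('b \<Rightarrow> 'b \<Rightarrow> real) \<Rightarrow> 'b topology \<Rightarrow> bool" where
  "metrizes d X \<longleftrightarrow>
     Metric_space (topspace X) d \<and> Metric_space.mtopology (topspace X) d = X"

text \<open>The empty set is weak* compact; its seminorm is the supremum of the empty set in
  \<open>[0, \<infinity>)\<close>, namely 0, whereas \<open>Sup {}\<close> is unspecified for reals.\<close>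

definition sup_seminorm :: "('a::cstar_algebra \<Rightarrow> complex) set \<Rightarrow> 'a \<Rightarrow> real" where
  "sup_seminorm K a = (if K = {} then 0 else (SUP \<phi>\<in>K. cmod (\<phi> a)))"

text \<open>The locally convex topology generated by a nonempty family of seminorms.\<close>

definition seminorm_topology :: "('a::real_vector \<Rightarrow> real) set \<Rightarrow> 'a topology" where
  "seminorm_topology P =
     topology_generated_by {{a. p (a - b) < r} | p b r. p \<in> P \<and> 0 < r}"

definition weakly_uniform :: "'a::cstar_algebra topology" where
  "weakly_uniform = seminorm_topology {sup_seminorm K | K. compactin state_topology K}"

definition totally_bounded_for :: "'a::real_vector topology \<Rightarrow> 'a set \<Rightarrow> bool" where
  "totally_bounded_for T V \<longleftrightarrow>
     (\<forall>U. openin T U \<and> 0 \<in> U \<longrightarrow>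
       (\<exists>F. finite F \<and> V \<subseteq> {u + f | u f. u \<in> U \<and> f \<in> F}))"

end

theory Submission
  imports Defs
begin

text \<open>
  An element \<open>a\<close> is viewed as the function \<open>\<phi> \<mapsto> \<phi> a\<close> on the states. Then the bounded-Lipschitz
  distance \<open>d\<close> is uniform distance over the unit ball \<open>B\<close> of the seminorm, so every element of
  \<open>B\<close> is 1-Lipschitz for \<open>d\<close>, and the weakly-uniform topology is uniform convergence on the weak*
  compact sets of states. Under this reading the theorem is a form of the Arzela-Ascoli theorem.

  Two facts hold for every seminorm with dense domain. First, \<open>d\<close> is a metric: each element of the
  domain has a positive multiple in \<open>B\<close>, and the domain is dense in the self-adjoint elements,
  which span the algebra over the complex numbers; so \<open>B\<close> separates states. Second, for the same
  reason all evaluations are continuous for \<open>d\<close>, so the topology of \<open>d\<close> is finer than the weak*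
  topology (\<open>evaluation_continuous\<close>, \<open>bl_topology_finer\<close>). Only the converse comparison is at stake.

  Suppose that \<open>d\<close> metrizes the weak* topology and let \<open>K\<close> be a weak* compact set of states. Then
  \<open>K\<close> is totally bounded for \<open>d\<close>, so it has a finite net \<open>T\<close>. As the elements of \<open>B\<close> are
  1-Lipschitz, an element of \<open>B\<close> is determined on \<open>K\<close> up to a small error by its values on \<open>T\<close>, and
  these values range over a bounded part of a finite-dimensional space. Hence finitely many elements
  of \<open>B\<close> approximate all of \<open>B\<close> uniformly on \<open>K\<close> (\<open>metrizes_imp_totally_bounded\<close>).

  Suppose conversely that \<open>B\<close> is totally bounded for the weakly-uniform topology. If a sequence of
  states converges weak*, it forms together with its limit a weak* compact set \<open>K\<close>. Up to a small
  error on \<open>K\<close>, each element of \<open>B\<close> is one of finitely many elements, and on finitely many elements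
  pointwise convergence is uniform; so the sequence converges for \<open>d\<close>
  (\<open>weak_star_convergence_imp_bl_convergence\<close>). Sequences suffice because the algebra is separable:
  on the states, which are equicontinuous, weak* convergence may be tested on a countable dense set
  (\<open>bl_ball_contains_weak_star_neighbourhood\<close>).
\<close>

section \<open>States and their weak* topology\<close>

lemma state_imp_bounded_linear: "\<phi> \<in> states \<Longrightarrow> bounded_linear \<phi>"
  by (simp add: states_def dual_space_def)

lemma state_norm_le:
  assumes "\<phi> \<in> states"
  shows "cmod (\<phi> a) \<le> norm a"
  using onorm[OF state_imp_bounded_linear[OF assms], of a] assms by (simp add: states_def)

lemma state_diff: "\<phi> \<in> states \<Longrightarrow> \<phi> (a - b) = \<phi> a - \<phi> b"
  by (metis bounded_linear.linear linear_diff state_imp_bounded_linear)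

text \<open>Equicontinuity of the states: they all have norm 1, so a bound on the difference of two states
  at \<open>b\<close> carries over to the elements close to \<open>b\<close>. This is what lets a dense set of elements stand
  for the whole algebra.\<close>

lemma states_diff_le:
  assumes "\<phi> \<in> states" "\<psi> \<in> states"
  shows "cmod (\<phi> a - \<psi> a) \<le> cmod (\<phi> b - \<psi> b) + 2 * norm (a - b)"
proof -
  have "\<phi> a - \<psi> a = (\<phi> b - \<psi> b) + \<phi> (a - b) - \<psi> (a - b)"
    using assms by (simp add: state_diff)
  then have "cmod (\<phi> a - \<psi> a) \<le> cmod (\<phi> b - \<psi> b) + cmod (\<phi> (a - b)) + cmod (\<psi> (a - b))"
    using norm_triangle_ineq[of "\<phi> b - \<psi> b" "\<phi> (a - b)"]
      norm_triangle_ineq4[of "\<phi> b - \<psi> b + \<phi> (a - b)" "\<psi> (a - b)"] by simp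
  then show ?thesis
    using state_norm_le[OF assms(1), of "a - b"] state_norm_le[OF assms(2), of "a - b"] by linarith
qed

text \<open>Splitting into real and imaginary parts. The domain of the seminorm is dense among the
  self-adjoint elements; this carries statements about states from these to all elements.\<close>

lemma self_adjoint_decomposition:
  fixes x :: "'a::cstar_algebra"
  obtains a b where "a \<in> self_adjoint" "b \<in> self_adjoint" "x = a + scaleC \<i> b"
proof -
  define a where "a = scaleC (1/2) (x + adj x)"
  define b where "b = scaleC (- \<i>/2) (x + scaleC (-1) (adj x))"
  have "a \<in> self_adjoint"
    by (simp add: self_adjoint_def a_def adj_scaleC adj_add adj_adj add.commute)
  moreover have "b \<in> self_adjoint"
    by (simp add: self_adjoint_def b_def adj_scaleC adj_add adj_adj scaleC_add_right scaleC_scaleC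
        add.commute)
  moreover have "x = a + scaleC \<i> b"
  proof -
    have one: "scaleC 1 y = y" for y :: 'a
      using scaleC_of_real[of 1 y] by simp
    have zero: "scaleC 0 y = 0" for y :: 'a
      using scaleC_of_real[of 0 y] by simp
    have "a + scaleC \<i> b
        = (scaleC (1/2) x + scaleC (1/2) x) + (scaleC (1/2) (adj x) + scaleC (-(1/2)) (adj x))"
      by (simp add: a_def b_def scaleC_add_right scaleC_scaleC)
    also have "\<dots> = x"
      by (simp only: scaleC_add_left[symmetric]) (simp add: one zero)
    finally show ?thesis by simp
  qed
  ultimately show thesis using that by blast
qed

lemma openin_state_evaluation:
  "openin state_topology {\<psi> \<in> states. cmod (\<psi> a - z) < e}"
proof -
  have "openin weak_star {\<psi> \<in> dual_space. \<psi> a \<in> ball z e}"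
    unfolding weak_star_def by (rule topology_generated_by_Basis) blast
  then have "openin state_topology (states \<inter> {\<psi> \<in> dual_space. \<psi> a \<in> ball z e})"
    unfolding state_topology_def by (simp add: openin_subtopology_Int2)
  moreover have "states \<inter> {\<psi> \<in> dual_space. \<psi> a \<in> ball z e} = {\<psi> \<in> states. cmod (\<psi> a - z) < e}"
    by (auto simp: states_def dist_norm norm_minus_commute)
  ultimately show ?thesis by simp
qed

text \<open>The evaluations generate the topology, and a finite intersection of conditions on single
  evaluations is a condition on finitely many of them, with the smallest of the radii.\<close>

lemma weak_star_basic_neighbourhood:
  assumes "openin weak_star U" "\<phi> \<in> U"
  shows "\<exists>F e. finite F \<and> 0 < e \<and> {\<psi> \<in> dual_space. \<forall>a\<in>F. cmod (\<psi> a - \<phi> a) < e} \<subseteq> U"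
  using assms(1)[unfolded weak_star_def openin_topology_generated_by_iff] assms(2)
proof (induction arbitrary: \<phi>)
  case Empty
  then show ?case by simp
next
  case (Int V W)
  then have \<phi>: "\<phi> \<in> V" "\<phi> \<in> W" by simp_all
  from Int.IH(1)[OF \<phi>(1)]
  obtain F e where F: "finite F" "0 < e" "{\<psi> \<in> dual_space. \<forall>a\<in>F. cmod (\<psi> a - \<phi> a) < e} \<subseteq> V"
    by (elim exE conjE)
  from Int.IH(2)[OF \<phi>(2)]
  obtain G d where G: "finite G" "0 < d" "{\<psi> \<in> dual_space. \<forall>a\<in>G. cmod (\<psi> a - \<phi> a) < d} \<subseteq> W"
    by (elim exE conjE)
  have "{\<psi> \<in> dual_space. \<forall>a\<in>F \<union> G. cmod (\<psi> a - \<phi> a) < min e d} \<subseteq> V \<inter> W"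
  proof (rule Int_greatest)
    show "{\<psi> \<in> dual_space. \<forall>a\<in>F \<union> G. cmod (\<psi> a - \<phi> a) < min e d} \<subseteq> V"
      by (rule order_trans[OF _ F(3)]) auto
    show "{\<psi> \<in> dual_space. \<forall>a\<in>F \<union> G. cmod (\<psi> a - \<phi> a) < min e d} \<subseteq> W"
      by (rule order_trans[OF _ G(3)]) auto
  qed
  moreover have "finite (F \<union> G)" "0 < min e d" using F(1,2) G(1,2) by simp_all
  ultimately show ?case by (intro exI conjI)
next
  case (UN \<U>)
  then obtain V where V: "V \<in> \<U>" "\<phi> \<in> V" by blast
  from UN.IH[OF V]
  obtain F e where F: "finite F" "0 < e" "{\<psi> \<in> dual_space. \<forall>a\<in>F. cmod (\<psi> a - \<phi> a) < e} \<subseteq> V"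
    by (elim exE conjE)
  from F(3) V(1) have "{\<psi> \<in> dual_space. \<forall>a\<in>F. cmod (\<psi> a - \<phi> a) < e} \<subseteq> \<Union>\<U>"
    by (rule order_trans[OF _ Union_upper])
  with F(1,2) show ?case by (intro exI conjI)
next
  case (Basis V)
  then obtain a W where V: "V = {\<psi> \<in> dual_space. \<psi> a \<in> W}" "open W" by blast
  then have "\<phi> a \<in> W" using Basis.prems by simp
  then obtain e where e: "0 < e" "ball (\<phi> a) e \<subseteq> W"
    using V(2) openE by blast
  have "{\<psi> \<in> dual_space. \<forall>b\<in>{a}. cmod (\<psi> b - \<phi> b) < e} \<subseteq> V"
    using e(2) by (auto simp: V(1) dist_norm norm_minus_commute subset_iff)
  with e(1) show ?case by (intro exI[of _ "{a}"] exI[of _ e]) simp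
qed

lemma state_basic_neighbourhood:
  assumes "openin state_topology U" "\<phi> \<in> U"
  obtains F e where "finite F" "0 < e" "{\<psi> \<in> states. \<forall>a\<in>F. cmod (\<psi> a - \<phi> a) < e} \<subseteq> U"
proof -
  obtain V where V: "openin weak_star V" "U = V \<inter> states"
    using assms(1) by (auto simp: state_topology_def openin_subtopology)
  then have "\<phi> \<in> V" using assms(2) by simp
  from weak_star_basic_neighbourhood[OF V(1) this]
  obtain F e where "finite F" "0 < e" "{\<psi> \<in> dual_space. \<forall>a\<in>F. cmod (\<psi> a - \<phi> a) < e} \<subseteq> V"
    by blast
  then show thesis using that[of F e] V(2) by (auto simp: states_def)
qed

lemma limitin_state_topology:
  assumes "\<phi> \<in> states" "\<And>n. \<psi> n \<in> states" "\<And>a. (\<lambda>n. \<psi> n a) \<longlonglongrightarrow> \<phi> a"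
  shows "limitin state_topology \<psi> \<phi> sequentially"
  unfolding limitin_def
proof (intro conjI allI impI)
  show "\<phi> \<in> topspace state_topology"
    using assms(1) by (simp add: topspace_state_topology)
next
  fix U assume "openin state_topology U \<and> \<phi> \<in> U"
  then have U: "openin state_topology U" "\<phi> \<in> U" by simp_all
  obtain F e where F: "finite F" "0 < e"
    "{\<rho> \<in> states. \<forall>a\<in>F. cmod (\<rho> a - \<phi> a) < e} \<subseteq> U"
    using state_basic_neighbourhood[OF U] .
  have "\<forall>\<^sub>F n in sequentially. \<forall>a\<in>F. cmod (\<psi> n a - \<phi> a) < e"
    using F(1) tendstoD[OF assms(3) F(2)] by (simp add: eventually_ball_finite dist_norm)
  then show "\<forall>\<^sub>F n in sequentially. \<psi> n \<in> U"
    by (rule eventually_mono) (use F(3) assms(2) in auto)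
qed

text \<open>On the equicontinuous set of states, pointwise convergence on a norm-dense set of elements is
  already weak* convergence.\<close>

lemma limitin_state_topology_dense:
  assumes "\<phi> \<in> states" "\<And>n. \<psi> n \<in> states"
    and dense: "closure (C :: 'a::cstar_algebra set) = UNIV"
    and lim: "\<And>c. c \<in> C \<Longrightarrow> (\<lambda>n. \<psi> n c) \<longlonglongrightarrow> \<phi> c"
  shows "limitin state_topology \<psi> \<phi> sequentially"
proof (rule limitin_state_topology[OF assms(1,2)])
  fix a :: 'a
  show "(\<lambda>n. \<psi> n a) \<longlonglongrightarrow> \<phi> a"
  proof (rule tendstoI)
    fix e :: real assume "0 < e"
    then obtain c where c: "c \<in> C" "norm (a - c) < e / 4"
      using dense closure_approachable[of a C]
      by (metis UNIV_I dist_norm norm_minus_commute zero_less_divide_iff zero_less_numeral)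
    have "\<forall>\<^sub>F n in sequentially. dist (\<psi> n c) (\<phi> c) < e / 2"
      using \<open>0 < e\<close> by (intro tendstoD[OF lim[OF c(1)]]) simp
    then show "\<forall>\<^sub>F n in sequentially. dist (\<psi> n a) (\<phi> a) < e"
    proof (rule eventually_mono)
      fix n assume "dist (\<psi> n c) (\<phi> c) < e / 2"
      then show "dist (\<psi> n a) (\<phi> a) < e"
        using states_diff_le[OF assms(2)[of n] assms(1), of a c] c(2) by (simp add: dist_norm)
    qed
  qed
qed

section \<open>Total boundedness for the weakly-uniform topology\<close>

lemma sup_seminorm_upper:
  assumes "K \<subseteq> states" "\<phi> \<in> K"
  shows "cmod (\<phi> a) \<le> sup_seminorm K a"
proof -
  have "cmod (\<psi> a) \<le> norm a" if "\<psi> \<in> K" for \<psi>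
    using that assms(1) by (intro state_norm_le) blast
  then have "bdd_above ((\<lambda>\<phi>. cmod (\<phi> a)) ` K)"
    by (rule bdd_aboveI2)
  from cSUP_upper[OF assms(2) this] show ?thesis
    using assms(2) by (auto simp: sup_seminorm_def)
qed

lemma sup_seminorm_least:
  assumes "0 \<le> r" "\<And>\<phi>. \<phi> \<in> K \<Longrightarrow> cmod (\<phi> a) \<le> r"
  shows "sup_seminorm K a \<le> r"
proof (cases "K = {}")
  case False
  then have "(SUP \<phi>\<in>K. cmod (\<phi> a)) \<le> r" using assms(2) by (rule cSUP_least)
  with False show ?thesis by (simp add: sup_seminorm_def)
qed (simp add: sup_seminorm_def assms(1))

lemma sup_seminorm_nonneg:
  assumes "K \<subseteq> states"
  shows "0 \<le> sup_seminorm K a"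
proof (cases "K = {}")
  case False
  then obtain \<phi> where "\<phi> \<in> K" by blast
  from sup_seminorm_upper[OF assms this, of a] show ?thesis
    using norm_ge_zero[of "\<phi> a"] by linarith
qed (simp add: sup_seminorm_def)

lemma compactin_states_subset: "compactin state_topology K \<Longrightarrow> K \<subseteq> states"
  using compactin_subset_topspace topspace_state_topology by blast

lemma openin_weakly_uniform_ball:
  assumes "compactin state_topology K" "0 < r"
  shows "openin weakly_uniform {a. sup_seminorm K a < r}"
proof -
  have "{a. sup_seminorm K (a - 0) < r} \<in>
      {{a. p (a - b) < r} |p b r. p \<in> {sup_seminorm K |K. compactin state_topology K} \<and> 0 < r}"
    using assms by blast
  from topology_generated_by_Basis[OF this] show ?thesis
    by (simp add: weakly_uniform_def seminorm_topology_def)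
qed

text \<open>A single seminorm ball suffices as a basic neighbourhood, with no finite intersections, because
  the family of seminorms is directed: the union of two compact sets is compact, and its seminorm
  dominates those of both parts.\<close>

lemma weakly_uniform_basic_neighbourhood:
  assumes "openin weakly_uniform U" "(x::'a::cstar_algebra) \<in> U"
  shows "\<exists>K r. compactin state_topology K \<and> 0 < r \<and> {a. sup_seminorm K (a - x) < r} \<subseteq> U"
  using assms(1)[unfolded weakly_uniform_def seminorm_topology_def openin_topology_generated_by_iff]
    assms(2)
proof (induction)
  case Empty
  then show ?case by simp
next
  case (Int V W)
  from Int have x: "x \<in> V" "x \<in> W" by simp_all
  from Int.IH(1)[OF x(1)]
  obtain K r where K: "compactin state_topology K" "0 < r" "{a. sup_seminorm K (a - x) < r} \<subseteq> V"
    by (elim exE conjE)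
  from Int.IH(2)[OF x(2)]
  obtain K' r' where K': "compactin state_topology K'" "0 < r'"
    "{a. sup_seminorm K' (a - x) < r'} \<subseteq> W"
    by (elim exE conjE)
  have KK': "compactin state_topology (K \<union> K')"
    using K(1) K'(1) by (rule compactin_Un)
  then have sub: "K \<union> K' \<subseteq> states" by (rule compactin_states_subset)
  have mono: "sup_seminorm K a \<le> sup_seminorm (K \<union> K') a"
    "sup_seminorm K' a \<le> sup_seminorm (K \<union> K') a" for a
    using sup_seminorm_upper[OF sub, of _ a] sup_seminorm_nonneg[OF sub, of a]
    by (simp_all add: sup_seminorm_least)
  have "{a. sup_seminorm (K \<union> K') (a - x) < min r r'} \<subseteq> V \<inter> W"
  proof
    fix a assume "a \<in> {a. sup_seminorm (K \<union> K') (a - x) < min r r'}"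
    then have "sup_seminorm K (a - x) < r" "sup_seminorm K' (a - x) < r'"
      using mono[of "a - x"] by simp_all
    then show "a \<in> V \<inter> W" using K(3) K'(3) by blast
  qed
  moreover have "0 < min r r'" using K(2) K'(2) by simp
  ultimately show ?case using KK' by (intro exI conjI)
next
  case (UN \<U>)
  then obtain V where V: "V \<in> \<U>" "x \<in> V" by blast
  from UN.IH[OF V]
  obtain K r where K: "compactin state_topology K" "0 < r" "{a. sup_seminorm K (a - x) < r} \<subseteq> V"
    by (elim exE conjE)
  from K(3) V(1) have "{a. sup_seminorm K (a - x) < r} \<subseteq> \<Union>\<U>"
    by (rule order_trans[OF _ Union_upper])
  with K(1,2) show ?case by (intro exI conjI)
next
  case (Basis V)
  then obtain K b r where V: "V = {a. sup_seminorm K (a - b) < r}" "compactin state_topology K"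
    by blast
  have sub: "K \<subseteq> states" using V(2) by (rule compactin_states_subset)
  have tri: "sup_seminorm K (a - b) \<le> sup_seminorm K (a - x) + sup_seminorm K (x - b)" for a
  proof (rule sup_seminorm_least)
    fix \<phi> assume \<phi>: "\<phi> \<in> K"
    then have "\<phi> (a - b) = \<phi> (a - x) + \<phi> (x - b)" using sub by (auto simp: state_diff)
    then have "cmod (\<phi> (a - b)) \<le> cmod (\<phi> (a - x)) + cmod (\<phi> (x - b))"
      using norm_triangle_ineq[of "\<phi> (a - x)" "\<phi> (x - b)"] by simp
    then show "cmod (\<phi> (a - b)) \<le> sup_seminorm K (a - x) + sup_seminorm K (x - b)"
      using sup_seminorm_upper[OF sub \<phi>, of "a - x"] sup_seminorm_upper[OF sub \<phi>, of "x - b"]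
      by linarith
  qed (simp add: sub sup_seminorm_nonneg)
  have "{a. sup_seminorm K (a - x) < r - sup_seminorm K (x - b)} \<subseteq> V"
  proof
    fix a assume "a \<in> {a. sup_seminorm K (a - x) < r - sup_seminorm K (x - b)}"
    then show "a \<in> V" using tri[of a] by (simp add: V(1))
  qed
  moreover have "0 < r - sup_seminorm K (x - b)" using Basis V(1) by simp
  ultimately show ?case using V(2) by (intro exI conjI)
qed

text \<open>Total boundedness in terms of approximation on compact sets, the form in which both directions
  of the theorem use it. It holds since the seminorm balls around 0 form a neighbourhood base at 0
  that consists of open sets.\<close>

lemma totally_bounded_weakly_uniform_iff:
  "totally_bounded_for weakly_uniform (V :: 'a::cstar_algebra set) \<longleftrightarrow>
    (\<forall>K r. compactin state_topology K \<and> 0 < r \<longrightarrow>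
      (\<exists>F. finite F \<and> (\<forall>v\<in>V. \<exists>f\<in>F. sup_seminorm K (v - f) < r)))"
  (is "?L \<longleftrightarrow> ?R")
proof
  assume L: ?L
  show ?R
  proof (intro allI impI)
    fix K :: "('a \<Rightarrow> complex) set" and r :: real
    assume K: "compactin state_topology K \<and> 0 < r"
    have "cmod (\<phi> 0) \<le> 0" if "\<phi> \<in> K" for \<phi>
      using state_norm_le[of \<phi> 0] compactin_states_subset[of K] K that by auto
    then have "sup_seminorm K (0::'a) \<le> 0" by (intro sup_seminorm_least) simp_all
    with K have "(0::'a) \<in> {a. sup_seminorm K a < r}" by simp
    then obtain F where F: "finite F" "V \<subseteq> {u + f |u f. u \<in> {a. sup_seminorm K a < r} \<and> f \<in> F}"
      using L K openin_weakly_uniform_ball[of K r] unfolding totally_bounded_for_def by blast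
    have "\<exists>f\<in>F. sup_seminorm K (v - f) < r" if v: "v \<in> V" for v
    proof -
      obtain u f where "v = u + f" "sup_seminorm K u < r" "f \<in> F" using F(2) v by blast
      then show ?thesis by (intro bexI[of _ f]) auto
    qed
    then show "\<exists>F. finite F \<and> (\<forall>v\<in>V. \<exists>f\<in>F. sup_seminorm K (v - f) < r)"
      using F(1) by blast
  qed
next
  assume R: ?R
  show ?L
    unfolding totally_bounded_for_def
  proof (intro allI impI)
    fix U :: "'a set" assume "openin weakly_uniform U \<and> 0 \<in> U"
    with weakly_uniform_basic_neighbourhood[of U 0]
    obtain K r where K: "compactin state_topology K" "0 < r" "{a. sup_seminorm K a < r} \<subseteq> U"
      by auto
    then obtain F where F: "finite F" "\<forall>v\<in>V. \<exists>f\<in>F. sup_seminorm K (v - f) < r"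
      using R by blast
    have "V \<subseteq> {u + f |u f. u \<in> U \<and> f \<in> F}"
    proof
      fix v assume "v \<in> V"
      then obtain f where "f \<in> F" "v - f \<in> U" using F(2) K(3) by blast
      then show "v \<in> {u + f |u f. u \<in> U \<and> f \<in> F}"
        by (intro CollectI exI[of _ "v - f"] exI[of _ f]) simp
    qed
    with F(1) show "\<exists>F. finite F \<and> V \<subseteq> {u + f |u f. u \<in> U \<and> f \<in> F}" by blast
  qed
qed

text \<open>The finite-dimensional core of the Arzela-Ascoli argument, a pigeonhole principle: round all
  values to a finite net of a compact set that contains them. Only finitely many patterns of rounded
  values on \<open>T\<close> arise, and one representative of each pattern is enough.\<close>

lemma finite_net_of_bounded_evaluations:
  fixes T :: "('b \<Rightarrow> 'c::heine_borel) set"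
  assumes "finite T" "0 < e" "\<And>t. t \<in> T \<Longrightarrow> bounded (t ` V)"
  shows "\<exists>F. finite F \<and> F \<subseteq> V \<and> (\<forall>v\<in>V. \<exists>f\<in>F. \<forall>t\<in>T. dist (t v) (t f) < e)"
proof -
  have "bounded (\<Union>t\<in>T. t ` V)" using assms by (intro bounded_UN) auto
  then have "compact (closure (\<Union>t\<in>T. t ` V))" by simp
  then have "\<exists>C. finite C \<and> closure (\<Union>t\<in>T. t ` V) \<subseteq> (\<Union>c\<in>C. ball c (e/2))"
    unfolding compact_eq_totally_bounded using half_gt_zero[OF \<open>0 < e\<close>] by blast
  then obtain C where C: "finite C" "closure (\<Union>t\<in>T. t ` V) \<subseteq> (\<Union>c\<in>C. ball c (e/2))"
    by (elim exE conjE)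
  have "\<forall>z\<in>(\<Union>t\<in>T. t ` V). \<exists>c\<in>C. dist c z < e/2"
  proof
    fix z assume "z \<in> (\<Union>t\<in>T. t ` V)"
    then have "z \<in> closure (\<Union>t\<in>T. t ` V)" by (rule subsetD[OF closure_subset])
    with C(2) have "z \<in> (\<Union>c\<in>C. ball c (e/2))" by (rule subsetD)
    then show "\<exists>c\<in>C. dist c z < e/2" by simp
  qed
  then have "\<exists>k. \<forall>z\<in>(\<Union>t\<in>T. t ` V). k z \<in> C \<and> dist (k z) z < e/2"
    unfolding Bex_def by (rule bchoice)
  then obtain k where "\<forall>z\<in>(\<Union>t\<in>T. t ` V). k z \<in> C \<and> dist (k z) z < e/2"
    by (elim exE)
  then have k: "k (t v) \<in> C \<and> dist (k (t v)) (t v) < e/2" if "t \<in> T" "v \<in> V" for t v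
    using that by simp
  \<comment> \<open>Restricting to \<open>T\<close> makes the pattern of rounded values a member of a finite product.\<close>
  define h where "h v = restrict (\<lambda>t. k (t v)) T" for v
  have "h ` V \<subseteq> (\<Pi>\<^sub>E t\<in>T. C)" using k by (auto simp: h_def)
  then have "finite (h ` V)" using assms(1) C(1) by (meson finite_PiE finite_subset)
  then obtain F where F: "F \<subseteq> V" "finite F" "h ` V = h ` F"
    using finite_subset_image[of "h ` V" h V] by auto
  have "\<exists>f\<in>F. \<forall>t\<in>T. dist (t v) (t f) < e" if v: "v \<in> V" for v
  proof -
    obtain f where f: "f \<in> F" "h v = h f" using F(3) v by blast
    have "dist (t v) (t f) < e" if t: "t \<in> T" for t
    proof -
      have "k (t v) = k (t f)" using f(2) t unfolding h_def by (metis restrict_apply')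
      then have "dist (k (t v)) (t v) < e/2" "dist (k (t v)) (t f) < e/2"
        using k[OF t v] k[OF t, of f] f(1) F(1) by auto
      then show ?thesis by (metis dist_commute dist_triangle_half_r)
    qed
    then show ?thesis using f(1) by blast
  qed
  then show ?thesis using F(1,2) by (intro exI[of _ F] conjI ballI)
qed

section \<open>The bounded-Lipschitz metric\<close>

context
  fixes D :: "'a::cstar_algebra set" and L :: "'a \<Rightarrow> real"
  assumes dense: "self_adjoint \<subseteq> closure D"
    and semi: "seminorm_on D L"
begin

lemma zero_in_lip_ball: "0 \<in> lip_ball D L"
proof -
  have D0: "0 \<in> D" using semi by (simp add: seminorm_on_def subspace_0)
  then have "L (0 *\<^sub>R 0) = \<bar>0\<bar> * L 0" using semi unfolding seminorm_on_def by blast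
  with D0 show ?thesis by (simp add: lip_ball_def)
qed

lemma scaled_into_lip_ball:
  assumes "a \<in> D"
  obtains s where "0 < s" "s *\<^sub>R a \<in> lip_ball D L"
proof -
  \<comment> \<open>The 1 in the denominator keeps it positive when \<open>L a\<close> and \<open>a\<close> vanish.\<close>
  define s where "s = 1 / (1 + L a + norm a)"
  have La: "0 \<le> L a" "L (s *\<^sub>R a) = \<bar>s\<bar> * L a" "s *\<^sub>R a \<in> D"
    using semi assms by (auto simp: seminorm_on_def subspace_scale)
  then have pos: "0 < 1 + L a + norm a" by (simp add: add_pos_nonneg)
  then have s: "0 < s" "s * (1 + L a + norm a) = 1" by (auto simp: s_def)
  have "s * L a \<le> s * (1 + L a + norm a)" "s * norm a \<le> s * (1 + L a + norm a)"
    using s(1) La(1) by (auto intro!: mult_left_mono)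
  then have "s * L a \<le> 1" "s * norm a \<le> 1" using s(2) by auto
  then show thesis using that[of s] s(1) La by (auto simp: lip_ball_def)
qed

text \<open>The supremum that defines the distance is over a set bounded by 2, as states have norm 1 and
  the elements of the ball have norm at most 1. It is therefore a genuine upper bound, which makes
  every element of the ball 1-Lipschitz.\<close>

lemma bl_dist_upper:
  assumes "\<phi> \<in> states" "\<psi> \<in> states" "a \<in> lip_ball D L"
  shows "cmod (\<phi> a - \<psi> a) \<le> bl_dist D L \<phi> \<psi>"
proof -
  have "cmod (\<phi> a - \<psi> a) \<le> 2" if "a \<in> lip_ball D L" for a
    using states_diff_le[OF assms(1,2), of a 0] state_diff[OF assms(1), of 0 0]
      state_diff[OF assms(2), of 0 0] that
    by (simp add: lip_ball_def)
  then have "bdd_above ((\<lambda>a. cmod (\<phi> a - \<psi> a)) ` lip_ball D L)"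
    by (intro bdd_aboveI[of _ 2]) auto
  from cSUP_upper[OF assms(3) this] show ?thesis using assms(1,2) by (simp add: bl_dist_def)
qed

lemma bl_dist_least:
  assumes "\<phi> \<in> states" "\<psi> \<in> states" "\<And>a. a \<in> lip_ball D L \<Longrightarrow> cmod (\<phi> a - \<psi> a) \<le> r"
  shows "bl_dist D L \<phi> \<psi> \<le> r"
  using assms zero_in_lip_ball by (auto simp: bl_dist_def intro!: cSUP_least)

text \<open>Scaling into the ball; the Lipschitz constant is the inverse of the scaling factor.\<close>

lemma state_evaluation_lipschitz:
  assumes "a \<in> D"
  shows "\<exists>c>0. \<forall>\<phi>\<in>states. \<forall>\<psi>\<in>states. cmod (\<phi> a - \<psi> a) \<le> c * bl_dist D L \<phi> \<psi>"
proof -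
  obtain s where s: "0 < s" "s *\<^sub>R a \<in> lip_ball D L" using scaled_into_lip_ball[OF assms] .
  have "cmod (\<phi> a - \<psi> a) \<le> (1/s) * bl_dist D L \<phi> \<psi>" if st: "\<phi> \<in> states" "\<psi> \<in> states" for \<phi> \<psi>
  proof -
    have "\<rho> (s *\<^sub>R a) = s *\<^sub>R \<rho> a" if "\<rho> \<in> states" for \<rho>
      by (rule linear_scale[OF bounded_linear.linear[OF state_imp_bounded_linear[OF that]]])
    then have "\<phi> (s *\<^sub>R a) - \<psi> (s *\<^sub>R a) = s *\<^sub>R (\<phi> a - \<psi> a)"
      using st by (simp add: scaleR_diff_right)
    then have "cmod (\<phi> (s *\<^sub>R a) - \<psi> (s *\<^sub>R a)) = s * cmod (\<phi> a - \<psi> a)"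
      using s(1) by simp
    then show ?thesis using bl_dist_upper[OF st s(2)] s(1) by (simp add: field_simps)
  qed
  then show ?thesis using s(1) by (intro exI[of _ "1/s"]) simp
qed

text \<open>Passing from the domain to its norm closure costs the Lipschitz constant, as the constants of
  approximating elements may be unbounded, but it keeps uniform continuity.\<close>

lemma self_adjoint_evaluation_continuous:
  assumes "a \<in> self_adjoint" "0 < e"
  shows "\<exists>d>0. \<forall>\<phi>\<in>states. \<forall>\<psi>\<in>states. bl_dist D L \<phi> \<psi> < d \<longrightarrow> cmod (\<phi> a - \<psi> a) < e"
proof -
  have "\<exists>b\<in>D. dist b a < e / 4"
    using assms dense closure_approachable[of a D] by (metis divide_pos_pos subsetD zero_less_numeral)
  then obtain b where b: "b \<in> D" "norm (a - b) < e / 4"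
    by (auto simp: dist_norm norm_minus_commute)
  obtain c where c: "0 < c"
    "\<And>\<phi> \<psi>. \<phi> \<in> states \<Longrightarrow> \<psi> \<in> states \<Longrightarrow> cmod (\<phi> b - \<psi> b) \<le> c * bl_dist D L \<phi> \<psi>"
    using state_evaluation_lipschitz[OF b(1)] by blast
  have "cmod (\<phi> a - \<psi> a) < e"
    if st: "\<phi> \<in> states" "\<psi> \<in> states" and "bl_dist D L \<phi> \<psi> < e / (2 * c)" for \<phi> \<psi>
  proof -
    have "c * bl_dist D L \<phi> \<psi> < e / 2" using that(3) c(1) by (simp add: field_simps)
    then show ?thesis using c(2)[OF st] states_diff_le[OF st, of a b] b(2) by linarith
  qed
  then show ?thesis using assms(2) c(1) by (intro exI[of _ "e / (2 * c)"]) simp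
qed

lemma evaluation_continuous:
  fixes a :: 'a
  assumes "0 < e"
  shows "\<exists>d>0. \<forall>\<phi>\<in>states. \<forall>\<psi>\<in>states. bl_dist D L \<phi> \<psi> < d \<longrightarrow> cmod (\<phi> a - \<psi> a) < e"
proof -
  obtain x y where xy: "x \<in> self_adjoint" "y \<in> self_adjoint" "a = x + scaleC \<i> y"
    by (rule self_adjoint_decomposition)
  have "0 < e / 2" using assms by simp
  from self_adjoint_evaluation_continuous[OF xy(1) this]
  obtain d where d: "0 < d"
    "\<And>\<phi> \<psi>. \<phi> \<in> states \<Longrightarrow> \<psi> \<in> states \<Longrightarrow> bl_dist D L \<phi> \<psi> < d \<Longrightarrow> cmod (\<phi> x - \<psi> x) < e/2"
    by blast
  from self_adjoint_evaluation_continuous[OF xy(2) \<open>0 < e / 2\<close>]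
  obtain d' where d': "0 < d'"
    "\<And>\<phi> \<psi>. \<phi> \<in> states \<Longrightarrow> \<psi> \<in> states \<Longrightarrow> bl_dist D L \<phi> \<psi> < d' \<Longrightarrow> cmod (\<phi> y - \<psi> y) < e/2"
    by blast
  have ev: "\<rho> a = \<rho> x + \<i> * \<rho> y" if "\<rho> \<in> states" for \<rho>
    using that linear_add[OF bounded_linear.linear[OF state_imp_bounded_linear[OF that]]] xy(3)
    by (simp add: states_def dual_space_def)
  have "cmod (\<phi> a - \<psi> a) < e"
    if st: "\<phi> \<in> states" "\<psi> \<in> states" and "bl_dist D L \<phi> \<psi> < min d d'" for \<phi> \<psi>
  proof -
    have "\<phi> a - \<psi> a = (\<phi> x - \<psi> x) + \<i> * (\<phi> y - \<psi> y)"
      using ev[OF st(1)] ev[OF st(2)] by (simp add: algebra_simps)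
    then have "cmod (\<phi> a - \<psi> a) \<le> cmod (\<phi> x - \<psi> x) + cmod (\<phi> y - \<psi> y)"
      using norm_triangle_ineq[of "\<phi> x - \<psi> x" "\<i> * (\<phi> y - \<psi> y)"] by (simp add: norm_mult)
    then show ?thesis using d(2)[OF st] d'(2)[OF st] that(3) by simp
  qed
  then show ?thesis using d(1) d'(1) by (intro exI[of _ "min d d'"]) simp
qed

text \<open>Distinct states have positive distance because all evaluations are continuous for the
  distance: two states at distance 0 agree everywhere.\<close>

lemma Metric_space_bl_dist: "Metric_space states (bl_dist D L)"
proof
  fix \<phi> \<psi> \<rho> :: "'a \<Rightarrow> complex"
  show "0 \<le> bl_dist D L \<phi> \<psi>"
  proof (cases "\<phi> \<in> states \<and> \<psi> \<in> states")
    case True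
    then show ?thesis
      using bl_dist_upper[OF _ _ zero_in_lip_ball, of \<phi> \<psi>] norm_ge_zero[of "\<phi> 0 - \<psi> 0"] by linarith
  qed (auto simp: bl_dist_def)
  show "bl_dist D L \<phi> \<psi> = bl_dist D L \<psi> \<phi>"
    by (simp add: bl_dist_def norm_minus_commute)
  assume st: "\<phi> \<in> states" "\<psi> \<in> states"
  show "bl_dist D L \<phi> \<psi> = 0 \<longleftrightarrow> \<phi> = \<psi>"
  proof
    assume zero: "bl_dist D L \<phi> \<psi> = 0"
    have "cmod (\<phi> a - \<psi> a) \<le> 0" for a
    proof (rule field_le_epsilon)
      fix e :: real assume "0 < e"
      then show "cmod (\<phi> a - \<psi> a) \<le> 0 + e"
        using evaluation_continuous[of e a] st zero by fastforce
    qed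
    then show "\<phi> = \<psi>" by (simp add: fun_eq_iff)
  next
    assume "\<phi> = \<psi>"
    then show "bl_dist D L \<phi> \<psi> = 0"
      using bl_dist_least[OF st, of 0] bl_dist_upper[OF st zero_in_lip_ball] by simp
  qed
  assume \<rho>: "\<rho> \<in> states"
  show "bl_dist D L \<phi> \<rho> \<le> bl_dist D L \<phi> \<psi> + bl_dist D L \<psi> \<rho>"
  proof (rule bl_dist_least[OF st(1) \<rho>])
    fix a assume a: "a \<in> lip_ball D L"
    have "cmod (\<phi> a - \<rho> a) \<le> cmod (\<phi> a - \<psi> a) + cmod (\<psi> a - \<rho> a)"
      using norm_triangle_ineq[of "\<phi> a - \<psi> a" "\<psi> a - \<rho> a"] by simp
    then show "cmod (\<phi> a - \<rho> a) \<le> bl_dist D L \<phi> \<psi> + bl_dist D L \<psi> \<rho>"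
      using bl_dist_upper[OF st a] bl_dist_upper[OF st(2) \<rho> a] by linarith
  qed
qed

interpretation bl: Metric_space states "bl_dist D L"
  by (rule Metric_space_bl_dist)

lemma bl_topology_finer:
  assumes "openin state_topology U"
  shows "openin bl.mtopology U"
  unfolding bl.openin_mtopology
proof (intro conjI allI impI)
  show U: "U \<subseteq> states"
    using openin_subset[OF assms] by (simp add: topspace_state_topology)
  fix \<phi> assume \<phi>: "\<phi> \<in> U"
  obtain F e where F: "finite F" "0 < e" "{\<psi> \<in> states. \<forall>a\<in>F. cmod (\<psi> a - \<phi> a) < e} \<subseteq> U"
    using state_basic_neighbourhood[OF assms \<phi>] .
  have "\<forall>a. \<exists>d>0. \<forall>\<psi>\<in>states. bl_dist D L \<phi> \<psi> < d \<longrightarrow> cmod (\<psi> a - \<phi> a) < e"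
  proof
    fix a
    have "\<phi> \<in> states" using \<phi> U by blast
    with evaluation_continuous[OF F(2), of a]
    show "\<exists>d>0. \<forall>\<psi>\<in>states. bl_dist D L \<phi> \<psi> < d \<longrightarrow> cmod (\<psi> a - \<phi> a) < e"
      by (metis norm_minus_commute)
  qed
  then obtain d where d: "\<And>a. 0 < d a"
    "\<And>a \<psi>. \<psi> \<in> states \<Longrightarrow> bl_dist D L \<phi> \<psi> < d a \<Longrightarrow> cmod (\<psi> a - \<phi> a) < e"
    by metis
  define r where "r = Min (insert 1 (d ` F))"
  have r: "0 < r" "\<And>a. a \<in> F \<Longrightarrow> r \<le> d a" using F(1) d(1) by (auto simp: r_def)
  have "bl.mball \<phi> r \<subseteq> U"
  proof
    fix \<psi> assume "\<psi> \<in> bl.mball \<phi> r"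
    then have "\<psi> \<in> states" "bl_dist D L \<phi> \<psi> < r" by auto
    then show "\<psi> \<in> U" using F(3) d(2) r(2) by fastforce
  qed
  then show "\<exists>r>0. bl.mball \<phi> r \<subseteq> U" using r(1) by blast
qed

section \<open>Metrization implies total boundedness\<close>

text \<open>The Arzela-Ascoli argument: the 1-Lipschitz elements of the ball are controlled on a compact
  set by their values on a finite net of it, and these values are bounded by 1. The error is
  \<open>r/4\<close> for each of the two passages between a point and the net, and \<open>r/4\<close> on the net.\<close>

lemma metrizes_imp_totally_bounded:
  assumes "bl.mtopology = (state_topology :: ('a \<Rightarrow> complex) topology)"
  shows "totally_bounded_for weakly_uniform (lip_ball D L)"
  unfolding totally_bounded_weakly_uniform_iff
proof (intro allI impI)
  fix K :: "('a \<Rightarrow> complex) set" and r :: real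
  assume K: "compactin state_topology K \<and> 0 < r"
  then have "bl.mtotally_bounded K"
    using bl.compactin_imp_mtotally_bounded assms by simp
  moreover have "0 < r/4" using K by simp
  ultimately have "\<exists>T. finite T \<and> T \<subseteq> K \<and> K \<subseteq> (\<Union>t\<in>T. bl.mball t (r/4))"
    unfolding bl.mtotally_bounded_def by (elim allE impE)
  then obtain T where T: "finite T" "T \<subseteq> K" "K \<subseteq> (\<Union>t\<in>T. bl.mball t (r/4))"
    by (elim exE conjE)
  have Kst: "K \<subseteq> states" using K compactin_states_subset by blast
  have bounded: "bounded (t ` lip_ball D L)" if "t \<in> T" for t
  proof (rule boundedI)
    fix z assume "z \<in> t ` lip_ball D L"
    then obtain a where "z = t a" "norm a \<le> 1" by (auto simp: lip_ball_def)
    then show "norm z \<le> 1" using state_norm_le[of t a] that T(2) Kst by auto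
  qed
  have "\<exists>F. finite F \<and> F \<subseteq> lip_ball D L \<and>
      (\<forall>v\<in>lip_ball D L. \<exists>f\<in>F. \<forall>t\<in>T. dist (t v) (t f) < r/4)"
    using T(1) \<open>0 < r/4\<close> bounded by (rule finite_net_of_bounded_evaluations)
  then obtain F where F: "finite F" "F \<subseteq> lip_ball D L"
    "\<forall>v\<in>lip_ball D L. \<exists>f\<in>F. \<forall>t\<in>T. dist (t v) (t f) < r/4"
    by (elim exE conjE)
  have "\<exists>f\<in>F. sup_seminorm K (v - f) < r" if v: "v \<in> lip_ball D L" for v
  proof -
    obtain f where f: "f \<in> F" "\<And>t. t \<in> T \<Longrightarrow> cmod (t v - t f) < r/4"
      using F(3) v unfolding dist_norm by blast
    have "sup_seminorm K (v - f) \<le> 3 * (r/4)"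
    proof (rule sup_seminorm_least)
      fix \<phi> assume \<phi>: "\<phi> \<in> K"
      then obtain t where t: "t \<in> T" "bl_dist D L t \<phi> < r/4" using T(3) by auto
      have st: "\<phi> \<in> states" "t \<in> states" using \<phi> t(1) T(2) Kst by auto
      have "cmod (t v - \<phi> v) < r/4" "cmod (t f - \<phi> f) < r/4"
        using bl_dist_upper[OF st(2,1) v] bl_dist_upper[OF st(2,1), of f] f(1) F(2) t(2) by auto
      moreover have "\<phi> (v - f) = (t v - t f) - (t v - \<phi> v) + (t f - \<phi> f)"
        using st by (simp add: state_diff)
      then have "cmod (\<phi> (v - f)) \<le> cmod (t v - t f) + cmod (t v - \<phi> v) + cmod (t f - \<phi> f)"
        using norm_triangle_ineq4[of "t v - t f" "t v - \<phi> v"]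
          norm_triangle_ineq[of "(t v - t f) - (t v - \<phi> v)" "t f - \<phi> f"] by simp
      ultimately show "cmod (\<phi> (v - f)) \<le> 3 * (r/4)" using f(2)[OF t(1)] by linarith
    qed (use K in simp)
    then show ?thesis using f(1) K by (intro bexI[of _ f]) linarith+
  qed
  then show "\<exists>F. finite F \<and> (\<forall>v\<in>lip_ball D L. \<exists>f\<in>F. sup_seminorm K (v - f) < r)"
    using F(1) by blast
qed

section \<open>Total boundedness implies metrization\<close>

text \<open>A convergent sequence together with its limit is compact, and it is to this compact set that
  total boundedness is applied. It reduces the supremum over the ball to finitely many elements,
  for which pointwise convergence is enough.\<close>

lemma weak_star_convergence_imp_bl_convergence:
  assumes tb: "totally_bounded_for weakly_uniform (lip_ball D L)"
    and st: "\<phi> \<in> states" "\<And>n. \<psi> n \<in> states"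
    and lim: "limitin state_topology \<psi> \<phi> sequentially"
    and "0 < e"
  shows "\<forall>\<^sub>F n in sequentially. bl_dist D L \<phi> (\<psi> n) < e"
proof -
  let ?K = "insert \<phi> (range \<psi>)"
  have "compactin state_topology ?K"
    using st by (intro compactin_sequence_with_limit[OF lim]) (auto simp: topspace_state_topology)
  moreover have "0 < e/4" using \<open>0 < e\<close> by simp
  ultimately have "\<exists>F. finite F \<and> (\<forall>v\<in>lip_ball D L. \<exists>f\<in>F. sup_seminorm ?K (v - f) < e/4)"
    by (rule tb[unfolded totally_bounded_weakly_uniform_iff, rule_format, OF conjI])
  then obtain F where F: "finite F"
    "\<forall>v\<in>lip_ball D L. \<exists>f\<in>F. sup_seminorm ?K (v - f) < e/4"
    by (elim exE conjE)
  have K: "?K \<subseteq> states" using st by auto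
  have "\<forall>\<^sub>F n in sequentially. \<forall>f\<in>F. cmod (\<psi> n f - \<phi> f) < e/4"
  proof (rule eventually_ball_finite[OF F(1)], rule)
    fix f
    have "\<phi> \<in> {\<rho> \<in> states. cmod (\<rho> f - \<phi> f) < e/4}" using st(1) \<open>0 < e\<close> by simp
    then have "\<forall>\<^sub>F n in sequentially. \<psi> n \<in> {\<rho> \<in> states. cmod (\<rho> f - \<phi> f) < e/4}"
      using lim openin_state_evaluation[of f "\<phi> f" "e/4"] unfolding limitin_def by blast
    then show "\<forall>\<^sub>F n in sequentially. cmod (\<psi> n f - \<phi> f) < e/4"
      by (rule eventually_mono) simp
  qed
  then show ?thesis
  proof (rule eventually_mono)
    fix n assume n: "\<forall>f\<in>F. cmod (\<psi> n f - \<phi> f) < e/4"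
    have "bl_dist D L \<phi> (\<psi> n) \<le> 3 * (e/4)"
    proof (rule bl_dist_least[OF st])
      fix a assume "a \<in> lip_ball D L"
      then obtain f where f: "f \<in> F" "sup_seminorm ?K (a - f) < e/4" using F(2) by blast
      have "cmod (\<phi> (a - f)) < e/4" "cmod (\<psi> n (a - f)) < e/4"
        using sup_seminorm_upper[OF K, of \<phi> "a - f"] sup_seminorm_upper[OF K, of "\<psi> n" "a - f"] f(2)
        by simp_all
      moreover have "\<phi> a - \<psi> n a = \<phi> (a - f) - \<psi> n (a - f) - (\<psi> n f - \<phi> f)"
        using st by (simp add: state_diff)
      then have "cmod (\<phi> a - \<psi> n a) \<le> cmod (\<phi> (a - f)) + cmod (\<psi> n (a - f)) + cmod (\<psi> n f - \<phi> f)"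
        using norm_triangle_ineq4[of "\<phi> (a - f)" "\<psi> n (a - f)"]
          norm_triangle_ineq4[of "\<phi> (a - f) - \<psi> n (a - f)" "\<psi> n f - \<phi> f"] by simp
      ultimately show "cmod (\<phi> a - \<psi> n a) \<le> 3 * (e/4)" using n f(1) by fastforce
    qed
    then show "bl_dist D L \<phi> (\<psi> n) < e" using \<open>0 < e\<close> by linarith
  qed
qed

text \<open>If no weak* neighbourhood of \<open>\<phi>\<close> were contained in the ball, one could pick states outside
  the ball that are ever closer to \<open>\<phi>\<close> at ever more elements of a countable dense set. They converge
  weak* to \<open>\<phi>\<close> without approaching it for the distance.\<close>

lemma bl_ball_contains_weak_star_neighbourhood:
  assumes sep: "separable_space (euclidean :: 'a topology)"
    and tb: "totally_bounded_for weakly_uniform (lip_ball D L)"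
    and "\<phi> \<in> states" "0 < e"
  obtains U where "openin state_topology U" "\<phi> \<in> U" "U \<subseteq> bl.mball \<phi> e"
proof -
  obtain C :: "'a set" where C: "countable C" "closure C = UNIV"
    using sep by (auto simp: separable_space_def)
  then have "C \<noteq> {}" by auto
  define c where "c = from_nat_into C"
  have c: "range c = C" using C(1) \<open>C \<noteq> {}\<close> by (simp add: c_def range_from_nat_into)
  define U where "U n = (\<Inter>k\<in>{..n}. {\<psi> \<in> states. cmod (\<psi> (c k) - \<phi> (c k)) < inverse (Suc n)})" for n
  have U: "openin state_topology (U n)" "\<phi> \<in> U n" for n
    unfolding U_def using assms(3)
    by (auto intro!: openin_INT2 openin_state_evaluation)
  show thesis
  proof (rule ccontr)
    assume "\<not> thesis"
    then have "\<exists>\<psi>. \<psi> \<in> U n \<and> \<psi> \<notin> bl.mball \<phi> e" for n using that U by blast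
    then obtain \<psi> where \<psi>: "\<And>n. \<psi> n \<in> U n" "\<And>n. \<psi> n \<notin> bl.mball \<phi> e" by metis
    have st: "\<psi> n \<in> states" for n using \<psi>(1)[of n] by (auto simp: U_def)
    have "(\<lambda>n. \<psi> n (c k)) \<longlonglongrightarrow> \<phi> (c k)" for k
    proof (rule Lim_transform_bound[THEN LIM_zero_cancel])
      show "\<forall>\<^sub>F n in sequentially. norm (\<psi> n (c k) - \<phi> (c k)) \<le> norm (inverse (real (Suc n)))"
        using eventually_ge_at_top[of k]
      proof eventually_elim
        case (elim n)
        then have "cmod (\<psi> n (c k) - \<phi> (c k)) < inverse (Suc n)"
          using \<psi>(1)[of n] unfolding U_def by blast
        then show ?case by simp
      qed
      show "(\<lambda>n. inverse (real (Suc n))) \<longlonglongrightarrow> 0" by (rule LIMSEQ_inverse_real_of_nat)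
    qed
    then have "limitin state_topology \<psi> \<phi> sequentially"
      using c by (intro limitin_state_topology_dense[OF assms(3) st C(2)]) auto
    from weak_star_convergence_imp_bl_convergence[OF tb assms(3) st this assms(4)]
    obtain n where "bl_dist D L \<phi> (\<psi> n) < e"
      using eventually_happens'[OF sequentially_bot] by blast
    then show False using \<psi>(2)[of n] assms(3) st[of n] by simp
  qed
qed

lemma totally_bounded_imp_metrizes:
  assumes sep: "separable_space (euclidean :: 'a topology)"
    and tb: "totally_bounded_for weakly_uniform (lip_ball D L)"
  shows "bl.mtopology = (state_topology :: ('a \<Rightarrow> complex) topology)"
proof (rule topology_eq[THEN iffD2], intro allI iffI)
  fix U :: "('a \<Rightarrow> complex) set"
  assume U: "openin bl.mtopology U"
  show "openin state_topology U"
  proof (subst openin_subopen, intro ballI)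
    fix \<phi> assume "\<phi> \<in> U"
    then obtain e where "\<phi> \<in> states" "0 < e" "bl.mball \<phi> e \<subseteq> U"
      using U unfolding bl.openin_mtopology by blast
    then show "\<exists>V. openin state_topology V \<and> \<phi> \<in> V \<and> V \<subseteq> U"
      using bl_ball_contains_weak_star_neighbourhood[OF sep tb] by (metis order_trans)
  qed
qed (rule bl_topology_finer)

end

section \<open>The metrization theorem\<close>

theorem theorem2p6:
  fixes D :: "'a::cstar_algebra set" and L :: "'a \<Rightarrow> real"
  assumes "separable_space (euclidean :: 'a topology)"
    and "D \<subseteq> self_adjoint"
    and "self_adjoint \<subseteq> closure D"
    and "seminorm_on D L"
  shows "metrizes (bl_dist D L) (state_topology :: ('a \<Rightarrow> complex) topology) \<longleftrightarrow>
         totally_bounded_for (weakly_uniform :: 'a topology) (lip_ball D L)"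
  unfolding metrizes_def topspace_state_topology
  using Metric_space_bl_dist[OF assms(3,4)] metrizes_imp_totally_bounded[OF assms(3,4)]
    totally_bounded_imp_metrizes[OF assms(3,4) assms(1)]
  by blast

end
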